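(* Let $A$ be an anticommutative alternative algebra over a field $F$ with $\mathrm{Ann}(A)=0$. Then there exists an actor of $A$ in $\mathrm{Alt}$, and $\mathrm{Act}(A)=\mathfrak{B}_{\mathrm{Alt}}(A)=\mathfrak{B}(A)$.
   Context: Algebras: an algebra over a field $F$ is an $F$-vector space with an $F$-bilinear multiplication, not assumed associative or unital. $A$ is alternative if $x^2y=x(xy)$ and $yx^2=(yx)x$ for all $x,y\in A$. $A$ is g-alternative if for all $x,y,z\in A$: $x(yz)=(xy)z+(yx)z-y(xz)$ and $(xy)z=x(yz)+x(zy)-(xz)y$ (every alternative algebra is g-alternative). $\mathrm{Alt}$ and $\mathrm{gAlt}$ are the categories of alternative, resp. g-alternative, algebras over $F$. $A$ is anticommutative if $aa'=-a'a$ for all $a,a'\in A$. $\mathrm{Ann}(A)=\{z\in A\mid az=za=0\text{ for all }a\in A\}$. Derived actions: an action of an $F$-algebra $B$ on $A$ is a pair of $F$-bilinear maps $B\times A\to A$, $(b,a)\mapsto ba$, and $A\times B\to A$, $(a,b)\mapsto ab$. For $A$ g-alternative it is a derived action in $\mathrm{gAlt}$ if $B$ is g-alternative and for all $a,a_1,a_2\in A$, $b,b_1,b_2\in B$: $b(a_1a_2)=(ba_1)a_2+(a_1b)a_2-a_1(ba_2)$; $(a_1a_2)b=a_1(a_2b)+a_1(ba_2)-(a_1b)a_2$; $(ba_1)a_2=b(a_1a_2)+b(a_2a_1)-(ba_2)a_1$; $a_1(a_2b)=(a_1a_2)b+(a_2a_1)b-a_2(a_1b)$; $(b_1b_2)a=b_1(b_2a)+b_1(ab_2)-(b_1a)b_2$;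 $a(b_1b_2)=(ab_1)b_2+(b_1a)b_2-b_1(ab_2)$; $(ab_1)b_2=a(b_1b_2)+a(b_2b_1)-(ab_2)b_1$; $b_1(b_2a)=(b_1b_2)a+(b_2b_1)a-b_2(b_1a)$. For $A$ alternative it is a derived action in $\mathrm{Alt}$ if $B$ is alternative, all the identities above hold, and moreover $a(ba)=(ab)a$ and $b(ab)=(ba)b$ for all $a\in A$, $b\in B$. Actor: an actor of $A$ in $\mathrm{Alt}$ is an alternative algebra $\mathrm{Act}(A)$ with a derived action on $A$ in $\mathrm{Alt}$ such that for every alternative algebra $C$ with a derived action on $A$ in $\mathrm{Alt}$ there is a unique algebra homomorphism $\varphi\colon C\to\mathrm{Act}(A)$ with $ca=\varphi(c)a$ and $ac=a\varphi(c)$ for all $a\in A$, $c\in C$. $\mathfrak{B}(A)$ and $\mathfrak{B}_{\mathrm{Alt}}(A)$: for a pair $f$ of $F$-linear maps $A\to A$ write $fa$ for the value of the first map at $a$ and $af$ for the value of the second. On pairs define addition componentwise and a product $ff'$ by $(ff')a=f(f'a)+f(af')-(fa)f'$, $a(ff')=(af)f'+(fa)f'-f(af')$. Let $\mathbb{B}$ be the set of all pairs $(a\mapsto ba,\ a\mapsto ab)$, where $b$ ranges over all elements of all g-alternative algebras with a derived action on $A$ in $\mathrm{gAlt}$. $\mathfrak{B}(A)$ is the $F$-algebra of all pairs obtained from elements of $\mathbb{B}$ by repeatedly applying addition, negation and this product (pairs giving the same maps are identified). $\mathfrak{B}_{\mathrm{Alt}}(A)$ is defined in the same way, with $b$ ranging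 over all elements of all alternative algebras with a derived action on $A$ in $\mathrm{Alt}$. These algebras act on $A$ by $(f,a)\mapsto fa$, $(a,f)\mapsto af$; "$\mathrm{Act}(A)=\mathfrak{B}_{\mathrm{Alt}}(A)$" means that $\mathfrak{B}_{\mathrm{Alt}}(A)$ with this action is an actor of $A$ in $\mathrm{Alt}$. *)

theory Defs
  imports "HOL-Algebra.Module"
begin

section \<open>Nonassociative algebras\<close>

text \<open>
  Vector spaces over a field \<open>F\<close> are modules in the sense of \<^locale>\<open>module\<close> over a field;
  algebras are carried by the same record type. The multiplication of the record is only required
  to be bilinear, and its field \<open>one\<close> is never referred to.
\<close>

definition bilinear_map ::
  "('f, 'k) ring_scheme \<Rightarrow> ('f, 'u, 'm1) module_scheme \<Rightarrow> ('f, 'v, 'm2) module_scheme \<Rightarrow>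
   ('f, 'w, 'm3) module_scheme \<Rightarrow> ('u \<Rightarrow> 'v \<Rightarrow> 'w) \<Rightarrow> bool"
where
  "bilinear_map F U V W \<beta> \<longleftrightarrow>
     (\<forall>u\<in>carrier U. \<forall>v\<in>carrier V. \<beta> u v \<in> carrier W) \<and>
     (\<forall>u\<in>carrier U. \<forall>u'\<in>carrier U. \<forall>v\<in>carrier V.
        \<beta> (u \<oplus>\<^bsub>U\<^esub> u') v = \<beta> u v \<oplus>\<^bsub>W\<^esub> \<beta> u' v) \<and>
     (\<forall>u\<in>carrier U. \<forall>v\<in>carrier V. \<forall>v'\<in>carrier V.
        \<beta> u (v \<oplus>\<^bsub>V\<^esub> v') = \<beta> u v \<oplus>\<^bsub>W\<^esub> \<beta> u v') \<and>
     (\<forall>k\<in>carrier F. \<forall>u\<in>carrier U. \<forall>v\<in>carrier V.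
        \<beta> (k \<odot>\<^bsub>U\<^esub> u) v = k \<odot>\<^bsub>W\<^esub> \<beta> u v) \<and>
     (\<forall>k\<in>carrier F. \<forall>u\<in>carrier U. \<forall>v\<in>carrier V.
        \<beta> u (k \<odot>\<^bsub>V\<^esub> v) = k \<odot>\<^bsub>W\<^esub> \<beta> u v)"

lemma bilinear_mapD:
  assumes "bilinear_map F U V W \<beta>"
  shows "u \<in> carrier U \<Longrightarrow> v \<in> carrier V \<Longrightarrow> \<beta> u v \<in> carrier W"
    and "u \<in> carrier U \<Longrightarrow> u' \<in> carrier U \<Longrightarrow> v \<in> carrier V \<Longrightarrow>
      \<beta> (u \<oplus>\<^bsub>U\<^esub> u') v = \<beta> u v \<oplus>\<^bsub>W\<^esub> \<beta> u' v"
    and "u \<in> carrier U \<Longrightarrow> v \<in> carrier V \<Longrightarrow> v' \<in> carrier V \<Longrightarrow>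
      \<beta> u (v \<oplus>\<^bsub>V\<^esub> v') = \<beta> u v \<oplus>\<^bsub>W\<^esub> \<beta> u v'"
    and "k \<in> carrier F \<Longrightarrow> u \<in> carrier U \<Longrightarrow> v \<in> carrier V \<Longrightarrow>
      \<beta> (k \<odot>\<^bsub>U\<^esub> u) v = k \<odot>\<^bsub>W\<^esub> \<beta> u v"
    and "k \<in> carrier F \<Longrightarrow> u \<in> carrier U \<Longrightarrow> v \<in> carrier V \<Longrightarrow>
      \<beta> u (k \<odot>\<^bsub>V\<^esub> v) = k \<odot>\<^bsub>W\<^esub> \<beta> u v"
  using assms unfolding bilinear_map_def by blast+

definition nonassoc_algebra ::
  "('f, 'k) ring_scheme \<Rightarrow> ('f, 'a, 'm) module_scheme \<Rightarrow> bool"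
where
  "nonassoc_algebra F A \<longleftrightarrow>
     field F \<and> module F A \<and> bilinear_map F A A A (\<lambda>x y. x \<otimes>\<^bsub>A\<^esub> y)"

definition alternative_algebra ::
  "('f, 'k) ring_scheme \<Rightarrow> ('f, 'a, 'm) module_scheme \<Rightarrow> bool"
where
  "alternative_algebra F A \<longleftrightarrow>
     nonassoc_algebra F A \<and>
     (\<forall>x\<in>carrier A. \<forall>y\<in>carrier A.
        (x \<otimes>\<^bsub>A\<^esub> x) \<otimes>\<^bsub>A\<^esub> y = x \<otimes>\<^bsub>A\<^esub> (x \<otimes>\<^bsub>A\<^esub> y) \<and>
        y \<otimes>\<^bsub>A\<^esub> (x \<otimes>\<^bsub>A\<^esub> x) = (y \<otimes>\<^bsub>A\<^esub> x) \<otimes>\<^bsub>A\<^esub> x)"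

definition g_alternative_algebra ::
  "('f, 'k) ring_scheme \<Rightarrow> ('f, 'a, 'm) module_scheme \<Rightarrow> bool"
where
  "g_alternative_algebra F A \<longleftrightarrow>
     nonassoc_algebra F A \<and>
     (\<forall>x\<in>carrier A. \<forall>y\<in>carrier A. \<forall>z\<in>carrier A.
        x \<otimes>\<^bsub>A\<^esub> (y \<otimes>\<^bsub>A\<^esub> z) =
          ((x \<otimes>\<^bsub>A\<^esub> y) \<otimes>\<^bsub>A\<^esub> z \<oplus>\<^bsub>A\<^esub> (y \<otimes>\<^bsub>A\<^esub> x) \<otimes>\<^bsub>A\<^esub> z) \<ominus>\<^bsub>A\<^esub> y \<otimes>\<^bsub>A\<^esub> (x \<otimes>\<^bsub>A\<^esub> z) \<and>
        (x \<otimes>\<^bsub>A\<^esub> y) \<otimes>\<^bsub>A\<^esub> z =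
          (x \<otimes>\<^bsub>A\<^esub> (y \<otimes>\<^bsub>A\<^esub> z) \<oplus>\<^bsub>A\<^esub> x \<otimes>\<^bsub>A\<^esub> (z \<otimes>\<^bsub>A\<^esub> y)) \<ominus>\<^bsub>A\<^esub> (x \<otimes>\<^bsub>A\<^esub> z) \<otimes>\<^bsub>A\<^esub> y)"

lemma alternative_imp_g_alternative:
  assumes "alternative_algebra F A"
  shows "g_alternative_algebra F A"
proof -
  have alg: "nonassoc_algebra F A"
    and left: "\<And>x y. x \<in> carrier A \<Longrightarrow> y \<in> carrier A \<Longrightarrow>
      (x \<otimes>\<^bsub>A\<^esub> x) \<otimes>\<^bsub>A\<^esub> y = x \<otimes>\<^bsub>A\<^esub> (x \<otimes>\<^bsub>A\<^esub> y)"
    and right: "\<And>x y. x \<in> carrier A \<Longrightarrow> y \<in> carrier A \<Longrightarrow>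
      y \<otimes>\<^bsub>A\<^esub> (x \<otimes>\<^bsub>A\<^esub> x) = (y \<otimes>\<^bsub>A\<^esub> x) \<otimes>\<^bsub>A\<^esub> x"
    using assms by (auto simp: alternative_algebra_def)
  have bil: "bilinear_map F A A A (\<lambda>x y. x \<otimes>\<^bsub>A\<^esub> y)" and "module F A"
    using alg by (auto simp: nonassoc_algebra_def)
  interpret module F A by fact
  note D = bilinear_mapD(1-3)[OF bil]
  have cancel: "s = (u \<oplus>\<^bsub>A\<^esub> v) \<ominus>\<^bsub>A\<^esub> t"
    if "p \<oplus>\<^bsub>A\<^esub> u \<oplus>\<^bsub>A\<^esub> (v \<oplus>\<^bsub>A\<^esub> q) = p \<oplus>\<^bsub>A\<^esub> s \<oplus>\<^bsub>A\<^esub> (t \<oplus>\<^bsub>A\<^esub> q)"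
      and c: "p \<in> carrier A" "q \<in> carrier A" "s \<in> carrier A" "t \<in> carrier A"
        "u \<in> carrier A" "v \<in> carrier A" for p q s t u v
  proof -
    have "p \<oplus>\<^bsub>A\<^esub> q \<oplus>\<^bsub>A\<^esub> (u \<oplus>\<^bsub>A\<^esub> v) = p \<oplus>\<^bsub>A\<^esub> q \<oplus>\<^bsub>A\<^esub> (s \<oplus>\<^bsub>A\<^esub> t)"
      using that by (simp add: M.a_ac)
    then have "u \<oplus>\<^bsub>A\<^esub> v = s \<oplus>\<^bsub>A\<^esub> t"
      using c by simp
    then show ?thesis
      using c by (simp add: a_minus_def M.a_assoc M.r_neg)
  qed
  have g1: "x \<otimes>\<^bsub>A\<^esub> (y \<otimes>\<^bsub>A\<^esub> z) =
      ((x \<otimes>\<^bsub>A\<^esub> y) \<otimes>\<^bsub>A\<^esub> z \<oplus>\<^bsub>A\<^esub> (y \<otimes>\<^bsub>A\<^esub> x) \<otimes>\<^bsub>A\<^esub> z) \<ominus>\<^bsub>A\<^esub> y \<otimes>\<^bsub>A\<^esub> (x \<otimes>\<^bsub>A\<^esub> z)"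
    if c: "x \<in> carrier A" "y \<in> carrier A" "z \<in> carrier A" for x y z
    using left[of "x \<oplus>\<^bsub>A\<^esub> y" z] c
    by (intro cancel[of "x \<otimes>\<^bsub>A\<^esub> (x \<otimes>\<^bsub>A\<^esub> z)" _ _ "y \<otimes>\<^bsub>A\<^esub> (y \<otimes>\<^bsub>A\<^esub> z)"])
      (simp_all add: D left M.a_ac)
  have g2: "(x \<otimes>\<^bsub>A\<^esub> y) \<otimes>\<^bsub>A\<^esub> z =
      (x \<otimes>\<^bsub>A\<^esub> (y \<otimes>\<^bsub>A\<^esub> z) \<oplus>\<^bsub>A\<^esub> x \<otimes>\<^bsub>A\<^esub> (z \<otimes>\<^bsub>A\<^esub> y)) \<ominus>\<^bsub>A\<^esub> (x \<otimes>\<^bsub>A\<^esub> z) \<otimes>\<^bsub>A\<^esub> y"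
    if c: "x \<in> carrier A" "y \<in> carrier A" "z \<in> carrier A" for x y z
    using right[of "y \<oplus>\<^bsub>A\<^esub> z" x] c
    by (intro cancel[of "(x \<otimes>\<^bsub>A\<^esub> y) \<otimes>\<^bsub>A\<^esub> y" _ _ "(x \<otimes>\<^bsub>A\<^esub> z) \<otimes>\<^bsub>A\<^esub> z"])
      (simp_all add: D right M.a_ac)
  show ?thesis
    unfolding g_alternative_algebra_def using alg g1 g2 by blast
qed

definition anticommutative :: "('f, 'a, 'm) module_scheme \<Rightarrow> bool" where
  "anticommutative A \<longleftrightarrow>
     (\<forall>a\<in>carrier A. \<forall>a'\<in>carrier A. a \<otimes>\<^bsub>A\<^esub> a' = \<ominus>\<^bsub>A\<^esub> (a' \<otimes>\<^bsub>A\<^esub> a))"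

definition Ann :: "('f, 'a, 'm) module_scheme \<Rightarrow> 'a set" where
  "Ann A = {z \<in> carrier A. \<forall>a\<in>carrier A. a \<otimes>\<^bsub>A\<^esub> z = \<zero>\<^bsub>A\<^esub> \<and> z \<otimes>\<^bsub>A\<^esub> a = \<zero>\<^bsub>A\<^esub>}"

text \<open>
  Homomorphisms are extensional (\<^const>\<open>undefined\<close> off the carrier), so that equality of
  functions is equality of homomorphisms.
\<close>

definition algebra_hom ::
  "('f, 'k) ring_scheme \<Rightarrow> ('f, 'a, 'm) module_scheme \<Rightarrow> ('f, 'b, 'n) module_scheme \<Rightarrow> ('a \<Rightarrow> 'b) set"
where
  "algebra_hom F A B =
     {\<phi> \<in> carrier A \<rightarrow>\<^sub>E carrier B.
        (\<forall>x\<in>carrier A. \<forall>y\<in>carrier A. \<phi> (x \<oplus>\<^bsub>A\<^esub> y) = \<phi> x \<oplus>\<^bsub>B\<^esub> \<phi> y) \<and>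
        (\<forall>k\<in>carrier F. \<forall>x\<in>carrier A. \<phi> (k \<odot>\<^bsub>A\<^esub> x) = k \<odot>\<^bsub>B\<^esub> \<phi> x) \<and>
        (\<forall>x\<in>carrier A. \<forall>y\<in>carrier A. \<phi> (x \<otimes>\<^bsub>A\<^esub> y) = \<phi> x \<otimes>\<^bsub>B\<^esub> \<phi> y)}"


section \<open>Derived actions\<close>

text \<open>An action of \<open>B\<close> on \<open>A\<close> is given by \<open>l b a\<close>, written \<open>ba\<close>, and \<open>r a b\<close>, written \<open>ab\<close>.\<close>

definition derived_action_gAlt ::
  "('f, 'k) ring_scheme \<Rightarrow> ('f, 'a, 'm) module_scheme \<Rightarrow> ('f, 'b, 'n) module_scheme \<Rightarrow>
   ('b \<Rightarrow> 'a \<Rightarrow> 'a) \<Rightarrow> ('a \<Rightarrow> 'b \<Rightarrow> 'a) \<Rightarrow> bool"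
where
  "derived_action_gAlt F A B l r \<longleftrightarrow>
     g_alternative_algebra F A \<and> g_alternative_algebra F B \<and>
     bilinear_map F B A A l \<and> bilinear_map F A B A r \<and>
     (\<forall>b\<in>carrier B. \<forall>a1\<in>carrier A. \<forall>a2\<in>carrier A.
        l b (a1 \<otimes>\<^bsub>A\<^esub> a2) =
          (l b a1 \<otimes>\<^bsub>A\<^esub> a2 \<oplus>\<^bsub>A\<^esub> r a1 b \<otimes>\<^bsub>A\<^esub> a2) \<ominus>\<^bsub>A\<^esub> a1 \<otimes>\<^bsub>A\<^esub> l b a2 \<and>
        r (a1 \<otimes>\<^bsub>A\<^esub> a2) b =
          (a1 \<otimes>\<^bsub>A\<^esub> r a2 b \<oplus>\<^bsub>A\<^esub> a1 \<otimes>\<^bsub>A\<^esub> l b a2) \<ominus>\<^bsub>A\<^esub> r a1 b \<otimes>\<^bsub>A\<^esub> a2 \<and>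
        l b a1 \<otimes>\<^bsub>A\<^esub> a2 =
          (l b (a1 \<otimes>\<^bsub>A\<^esub> a2) \<oplus>\<^bsub>A\<^esub> l b (a2 \<otimes>\<^bsub>A\<^esub> a1)) \<ominus>\<^bsub>A\<^esub> l b a2 \<otimes>\<^bsub>A\<^esub> a1 \<and>
        a1 \<otimes>\<^bsub>A\<^esub> r a2 b =
          (r (a1 \<otimes>\<^bsub>A\<^esub> a2) b \<oplus>\<^bsub>A\<^esub> r (a2 \<otimes>\<^bsub>A\<^esub> a1) b) \<ominus>\<^bsub>A\<^esub> a2 \<otimes>\<^bsub>A\<^esub> r a1 b) \<and>
     (\<forall>b1\<in>carrier B. \<forall>b2\<in>carrier B. \<forall>a\<in>carrier A.
        l (b1 \<otimes>\<^bsub>B\<^esub> b2) a =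
          (l b1 (l b2 a) \<oplus>\<^bsub>A\<^esub> l b1 (r a b2)) \<ominus>\<^bsub>A\<^esub> r (l b1 a) b2 \<and>
        r a (b1 \<otimes>\<^bsub>B\<^esub> b2) =
          (r (r a b1) b2 \<oplus>\<^bsub>A\<^esub> r (l b1 a) b2) \<ominus>\<^bsub>A\<^esub> l b1 (r a b2) \<and>
        r (r a b1) b2 =
          (r a (b1 \<otimes>\<^bsub>B\<^esub> b2) \<oplus>\<^bsub>A\<^esub> r a (b2 \<otimes>\<^bsub>B\<^esub> b1)) \<ominus>\<^bsub>A\<^esub> r (r a b2) b1 \<and>
        l b1 (l b2 a) =
          (l (b1 \<otimes>\<^bsub>B\<^esub> b2) a \<oplus>\<^bsub>A\<^esub> l (b2 \<otimes>\<^bsub>B\<^esub> b1) a) \<ominus>\<^bsub>A\<^esub> l b2 (l b1 a))"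

text \<open>
  By \<open>alternative_imp_g_alternative\<close>, the g-alternativity of \<open>A\<close> and \<open>B\<close> contained in the first
  conjunct below asks nothing beyond alternativity.
\<close>

definition derived_action_Alt ::
  "('f, 'k) ring_scheme \<Rightarrow> ('f, 'a, 'm) module_scheme \<Rightarrow> ('f, 'b, 'n) module_scheme \<Rightarrow>
   ('b \<Rightarrow> 'a \<Rightarrow> 'a) \<Rightarrow> ('a \<Rightarrow> 'b \<Rightarrow> 'a) \<Rightarrow> bool"
where
  "derived_action_Alt F A B l r \<longleftrightarrow>
     derived_action_gAlt F A B l r \<and>
     alternative_algebra F A \<and> alternative_algebra F B \<and>
     (\<forall>a\<in>carrier A. \<forall>b\<in>carrier B.
        a \<otimes>\<^bsub>A\<^esub> l b a = r a b \<otimes>\<^bsub>A\<^esub> a \<and>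
        l b (r a b) = r (l b a) b)"


section \<open>Actors\<close>

text \<open>
  The type argument fixes the type over which the test algebras \<open>C\<close> range; it is meant to be used
  with a type variable that is universally quantified in the statement.
\<close>

definition is_actor_Alt ::
  "'c itself \<Rightarrow> ('f, 'k) ring_scheme \<Rightarrow> ('f, 'a, 'm) module_scheme \<Rightarrow> ('f, 'b, 'n) module_scheme \<Rightarrow>
   ('b \<Rightarrow> 'a \<Rightarrow> 'a) \<Rightarrow> ('a \<Rightarrow> 'b \<Rightarrow> 'a) \<Rightarrow> bool"
where
  "is_actor_Alt (_ :: 'c itself) F A Act l r \<longleftrightarrow>
     derived_action_Alt F A Act l r \<and>
     (\<forall>(C :: ('f, 'c) module) l' r'. derived_action_Alt F A C l' r' \<longrightarrow>
        (\<exists>!\<phi>. \<phi> \<in> algebra_hom F C Act \<and>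
           (\<forall>c\<in>carrier C. \<forall>a\<in>carrier A. l' c a = l (\<phi> c) a \<and> r' a c = r a (\<phi> c))))"


section \<open>The algebras of pairs of maps\<close>

text \<open>
  In a pair \<open>f\<close>, the value \<open>fa\<close> is \<open>fst f a\<close> and \<open>af\<close> is \<open>snd f a\<close>. Maps are extensional on
  \<open>carrier A\<close>, so equality of pairs means having the same values on \<open>A\<close>.
\<close>

type_synonym 'a map_pair = "('a \<Rightarrow> 'a) \<times> ('a \<Rightarrow> 'a)"

definition pair_add ::
  "('f, 'a, 'm) module_scheme \<Rightarrow> 'a map_pair \<Rightarrow> 'a map_pair \<Rightarrow> 'a map_pair"
where
  "pair_add A f f' =
     (\<lambda>a\<in>carrier A. fst f a \<oplus>\<^bsub>A\<^esub> fst f' a, \<lambda>a\<in>carrier A. snd f a \<oplus>\<^bsub>A\<^esub> snd f' a)"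

definition pair_neg :: "('f, 'a, 'm) module_scheme \<Rightarrow> 'a map_pair \<Rightarrow> 'a map_pair" where
  "pair_neg A f = (\<lambda>a\<in>carrier A. \<ominus>\<^bsub>A\<^esub> fst f a, \<lambda>a\<in>carrier A. \<ominus>\<^bsub>A\<^esub> snd f a)"

definition pair_zero :: "('f, 'a, 'm) module_scheme \<Rightarrow> 'a map_pair" where
  "pair_zero A = (\<lambda>a\<in>carrier A. \<zero>\<^bsub>A\<^esub>, \<lambda>a\<in>carrier A. \<zero>\<^bsub>A\<^esub>)"

definition pair_smult :: "('f, 'a, 'm) module_scheme \<Rightarrow> 'f \<Rightarrow> 'a map_pair \<Rightarrow> 'a map_pair" where
  "pair_smult A k f = (\<lambda>a\<in>carrier A. k \<odot>\<^bsub>A\<^esub> fst f a, \<lambda>a\<in>carrier A. k \<odot>\<^bsub>A\<^esub> snd f a)"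

definition pair_mult ::
  "('f, 'a, 'm) module_scheme \<Rightarrow> 'a map_pair \<Rightarrow> 'a map_pair \<Rightarrow> 'a map_pair"
where
  "pair_mult A f f' =
     (\<lambda>a\<in>carrier A. (fst f (fst f' a) \<oplus>\<^bsub>A\<^esub> fst f (snd f' a)) \<ominus>\<^bsub>A\<^esub> snd f' (fst f a),
      \<lambda>a\<in>carrier A. (snd f' (snd f a) \<oplus>\<^bsub>A\<^esub> snd f' (fst f a)) \<ominus>\<^bsub>A\<^esub> fst f (snd f' a))"

definition pair_algebra ::
  "('f, 'a, 'm) module_scheme \<Rightarrow> 'a map_pair set \<Rightarrow> ('f, 'a map_pair) module"
where
  "pair_algebra A S =
     \<lparr>carrier = S, monoid.mult = pair_mult A, one = undefined,
      zero = pair_zero A, add = pair_add A, smult = pair_smult A\<rparr>"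

definition action_pair ::
  "('f, 'a, 'm) module_scheme \<Rightarrow> ('b \<Rightarrow> 'a \<Rightarrow> 'a) \<Rightarrow> ('a \<Rightarrow> 'b \<Rightarrow> 'a) \<Rightarrow> 'b \<Rightarrow> 'a map_pair"
where
  "action_pair A l r b = (\<lambda>a\<in>carrier A. l b a, \<lambda>a\<in>carrier A. r a b)"

text \<open>
  The pairs coming from derived actions. In the definitions the acting algebra \<open>B\<close> has its
  carrier in the type of pairs of maps; this is no restriction: by the lemmas
  \<open>action_pair_in_BB_gAlt\<close> and \<open>action_pair_in_BB_Alt\<close> below, the pairs obtained from acting
  algebras over any other type are the same.
\<close>

definition BB_gAlt ::
  "('f, 'k) ring_scheme \<Rightarrow> ('f, 'a, 'm) module_scheme \<Rightarrow> 'a map_pair set"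
where
  "BB_gAlt F A = {action_pair A l r b | (B :: ('f, 'a map_pair) module) l r b.
     derived_action_gAlt F A B l r \<and> b \<in> carrier B}"

definition BB_Alt ::
  "('f, 'k) ring_scheme \<Rightarrow> ('f, 'a, 'm) module_scheme \<Rightarrow> 'a map_pair set"
where
  "BB_Alt F A = {action_pair A l r b | (B :: ('f, 'a map_pair) module) l r b.
     derived_action_Alt F A B l r \<and> b \<in> carrier B}"

inductive_set pair_closure ::
  "('f, 'a, 'm) module_scheme \<Rightarrow> 'a map_pair set \<Rightarrow> 'a map_pair set"
  for A :: "('f, 'a, 'm) module_scheme" and S :: "'a map_pair set"
where
  incl: "f \<in> S \<Longrightarrow> f \<in> pair_closure A S"
| add: "f \<in> pair_closure A S \<Longrightarrow> f' \<in> pair_closure A S \<Longrightarrow> pair_add A f f' \<in> pair_closure A S"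
| neg: "f \<in> pair_closure A S \<Longrightarrow> pair_neg A f \<in> pair_closure A S"
| mult: "f \<in> pair_closure A S \<Longrightarrow> f' \<in> pair_closure A S \<Longrightarrow> pair_mult A f f' \<in> pair_closure A S"

definition frakB ::
  "('f, 'k) ring_scheme \<Rightarrow> ('f, 'a, 'm) module_scheme \<Rightarrow> ('f, 'a map_pair) module"
where
  "frakB F A = pair_algebra A (pair_closure A (BB_gAlt F A))"

definition frakB_Alt ::
  "('f, 'k) ring_scheme \<Rightarrow> ('f, 'a, 'm) module_scheme \<Rightarrow> ('f, 'a map_pair) module"
where
  "frakB_Alt F A = pair_algebra A (pair_closure A (BB_Alt F A))"


section \<open>Independence of the type carrying the acting algebra\<close>

text \<open>
  The product of pairs reproduces the identities for \<open>(b\<^sub>1b\<^sub>2)a\<close> and \<open>a(b\<^sub>1b\<^sub>2)\<close>, so the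
  pairs induced by \<open>B\<close> form a homomorphic image of \<open>B\<close> that again has a derived action on \<open>A\<close>.
\<close>

text \<open>A surjection that is compatible with all operations transports the algebra structure.\<close>

locale algebra_image =
  fixes F :: "('f, 'k) ring_scheme" and B :: "('f, 'b, 'n) module_scheme"
    and P :: "('f, 'p, 'q) module_scheme" and \<pi> :: "'b \<Rightarrow> 'p"
  assumes alg: "nonassoc_algebra F B"
    and carrier_image: "carrier P = \<pi> ` carrier B"
    and \<pi>_add: "\<And>x y. x \<in> carrier B \<Longrightarrow> y \<in> carrier B \<Longrightarrow> \<pi> x \<oplus>\<^bsub>P\<^esub> \<pi> y = \<pi> (x \<oplus>\<^bsub>B\<^esub> y)"
    and \<pi>_mult: "\<And>x y. x \<in> carrier B \<Longrightarrow> y \<in> carrier B \<Longrightarrow> \<pi> x \<otimes>\<^bsub>P\<^esub> \<pi> y = \<pi> (x \<otimes>\<^bsub>B\<^esub> y)"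
    and \<pi>_smult: "\<And>k x. k \<in> carrier F \<Longrightarrow> x \<in> carrier B \<Longrightarrow> k \<odot>\<^bsub>P\<^esub> \<pi> x = \<pi> (k \<odot>\<^bsub>B\<^esub> x)"
    and \<pi>_zero: "\<zero>\<^bsub>P\<^esub> = \<pi> \<zero>\<^bsub>B\<^esub>"
begin

lemma field_F: "field F" and module_B: "module F B"
  and bilin_B: "bilinear_map F B B B (\<lambda>x y. x \<otimes>\<^bsub>B\<^esub> y)"
  using alg by (simp_all add: nonassoc_algebra_def)

lemma mult_closed_B: "x \<in> carrier B \<Longrightarrow> y \<in> carrier B \<Longrightarrow> x \<otimes>\<^bsub>B\<^esub> y \<in> carrier B"
  using bilinear_mapD(1)[OF bilin_B] .

lemma module_P: "module F P"
proof -
  interpret B: module F B by (rule module_B)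
  show ?thesis
  proof (rule moduleI)
    show "cring F" by (rule B.is_cring)
    show "abelian_group P"
    proof (rule abelian_groupI)
      fix x assume "x \<in> carrier P"
      then obtain u where u: "u \<in> carrier B" "x = \<pi> u" unfolding carrier_image by blast
      have "\<pi> (\<ominus>\<^bsub>B\<^esub> u) \<oplus>\<^bsub>P\<^esub> x = \<zero>\<^bsub>P\<^esub>"
        using u by (simp add: \<pi>_add \<pi>_zero B.l_neg)
      then show "\<exists>y\<in>carrier P. y \<oplus>\<^bsub>P\<^esub> x = \<zero>\<^bsub>P\<^esub>"
        unfolding carrier_image using u by blast
    qed (auto simp: carrier_image \<pi>_add \<pi>_zero B.a_ac)
  qed (auto simp: carrier_image \<pi>_add \<pi>_smult B.smult_l_distr B.smult_r_distr B.smult_assoc1)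
qed

lemma \<pi>_uminus:
  assumes "x \<in> carrier B"
  shows "\<ominus>\<^bsub>P\<^esub> \<pi> x = \<pi> (\<ominus>\<^bsub>B\<^esub> x)"
proof -
  interpret B: module F B by (rule module_B)
  interpret P: module F P by (rule module_P)
  have "\<pi> (\<ominus>\<^bsub>B\<^esub> x) \<oplus>\<^bsub>P\<^esub> \<pi> x = \<zero>\<^bsub>P\<^esub>"
    using assms by (simp add: \<pi>_add \<pi>_zero B.l_neg)
  moreover have "\<pi> x \<in> carrier P" "\<pi> (\<ominus>\<^bsub>B\<^esub> x) \<in> carrier P"
    using assms by (auto simp: carrier_image)
  ultimately show ?thesis
    by (metis P.minus_equality)
qed

lemma \<pi>_minus:
  assumes "x \<in> carrier B" "y \<in> carrier B"
  shows "\<pi> x \<ominus>\<^bsub>P\<^esub> \<pi> y = \<pi> (x \<ominus>\<^bsub>B\<^esub> y)"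
proof -
  interpret B: module F B by (rule module_B)
  show ?thesis
    using assms by (simp add: a_minus_def \<pi>_uminus \<pi>_add)
qed

lemma algebra_P: "nonassoc_algebra F P"
proof -
  interpret B: module F B by (rule module_B)
  note D = bilinear_mapD[OF bilin_B]
  have "bilinear_map F P P P (\<lambda>x y. x \<otimes>\<^bsub>P\<^esub> y)"
    unfolding bilinear_map_def carrier_image by (auto simp: \<pi>_add \<pi>_mult \<pi>_smult D)
  then show ?thesis
    using field_F module_P by (simp add: nonassoc_algebra_def)
qed

lemma alternative_P:
  assumes "alternative_algebra F B"
  shows "alternative_algebra F P"
  using assms algebra_P unfolding alternative_algebra_def carrier_image
  by (auto simp: \<pi>_mult mult_closed_B)

lemma g_alternative_P:
  assumes "g_alternative_algebra F B"
  shows "g_alternative_algebra F P"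
proof -
  interpret B: module F B by (rule module_B)
  have ids: "x \<otimes>\<^bsub>B\<^esub> (y \<otimes>\<^bsub>B\<^esub> z) =
      ((x \<otimes>\<^bsub>B\<^esub> y) \<otimes>\<^bsub>B\<^esub> z \<oplus>\<^bsub>B\<^esub> (y \<otimes>\<^bsub>B\<^esub> x) \<otimes>\<^bsub>B\<^esub> z) \<ominus>\<^bsub>B\<^esub> y \<otimes>\<^bsub>B\<^esub> (x \<otimes>\<^bsub>B\<^esub> z)"
    "(x \<otimes>\<^bsub>B\<^esub> y) \<otimes>\<^bsub>B\<^esub> z =
      (x \<otimes>\<^bsub>B\<^esub> (y \<otimes>\<^bsub>B\<^esub> z) \<oplus>\<^bsub>B\<^esub> x \<otimes>\<^bsub>B\<^esub> (z \<otimes>\<^bsub>B\<^esub> y)) \<ominus>\<^bsub>B\<^esub> (x \<otimes>\<^bsub>B\<^esub> z) \<otimes>\<^bsub>B\<^esub> y"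
    if "x \<in> carrier B" "y \<in> carrier B" "z \<in> carrier B" for x y z
    using assms that unfolding g_alternative_algebra_def by blast+
  show ?thesis
    unfolding g_alternative_algebra_def carrier_image ball_simps
  proof (intro conjI ballI, goal_cases)
    case 1 show ?case by (rule algebra_P)
  qed (simp only: \<pi>_mult \<pi>_add \<pi>_minus mult_closed_B B.a_closed;
      rule arg_cong[where f = \<pi>]; rule ids; assumption)+
qed

end

context
  fixes F :: "('f, 'k) ring_scheme" and A :: "('f, 'a, 'm) module_scheme"
    and B :: "('f, 'b, 'n) module_scheme" and l r
  assumes act: "derived_action_gAlt F A B l r"
begin

private abbreviation "\<pi> \<equiv> action_pair A l r"
private abbreviation "P \<equiv> (pair_algebra A (\<pi> ` carrier B) :: ('f, 'a map_pair) module)"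

private lemma bil: "bilinear_map F B A A l" "bilinear_map F A B A r"
  using act by (auto simp: derived_action_gAlt_def)

private lemma mods: "module F A" "module F B"
  using act by (auto simp: derived_action_gAlt_def g_alternative_algebra_def nonassoc_algebra_def)

private lemma multA: "x \<in> carrier A \<Longrightarrow> y \<in> carrier A \<Longrightarrow> x \<otimes>\<^bsub>A\<^esub> y \<in> carrier A"
  using act by (auto simp: derived_action_gAlt_def g_alternative_algebra_def nonassoc_algebra_def
      bilinear_map_def)

private lemma multB: "x \<in> carrier B \<Longrightarrow> y \<in> carrier B \<Longrightarrow> x \<otimes>\<^bsub>B\<^esub> y \<in> carrier B"
  using act by (auto simp: derived_action_gAlt_def g_alternative_algebra_def nonassoc_algebra_def
      bilinear_map_def)

private lemma zero_act:
  assumes "a \<in> carrier A"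
  shows "l \<zero>\<^bsub>B\<^esub> a = \<zero>\<^bsub>A\<^esub>" "r a \<zero>\<^bsub>B\<^esub> = \<zero>\<^bsub>A\<^esub>"
proof -
  interpret A: module F A by (rule mods)
  interpret B: module F B by (rule mods)
  have "l (\<zero>\<^bsub>F\<^esub> \<odot>\<^bsub>B\<^esub> \<zero>\<^bsub>B\<^esub>) a = \<zero>\<^bsub>F\<^esub> \<odot>\<^bsub>A\<^esub> l \<zero>\<^bsub>B\<^esub> a"
    "r a (\<zero>\<^bsub>F\<^esub> \<odot>\<^bsub>B\<^esub> \<zero>\<^bsub>B\<^esub>) = \<zero>\<^bsub>F\<^esub> \<odot>\<^bsub>A\<^esub> r a \<zero>\<^bsub>B\<^esub>"
    by (intro bilinear_mapD(4)[OF bil(1)] bilinear_mapD(5)[OF bil(2)]; simp add: assms)+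
  then show "l \<zero>\<^bsub>B\<^esub> a = \<zero>\<^bsub>A\<^esub>" "r a \<zero>\<^bsub>B\<^esub> = \<zero>\<^bsub>A\<^esub>"
    using assms bilinear_mapD(1)[OF bil(1)] bilinear_mapD(1)[OF bil(2)] by simp_all
qed

private lemma act_ids:
  assumes "b \<in> carrier B" "a1 \<in> carrier A" "a2 \<in> carrier A"
  shows "l b (a1 \<otimes>\<^bsub>A\<^esub> a2) =
      (l b a1 \<otimes>\<^bsub>A\<^esub> a2 \<oplus>\<^bsub>A\<^esub> r a1 b \<otimes>\<^bsub>A\<^esub> a2) \<ominus>\<^bsub>A\<^esub> a1 \<otimes>\<^bsub>A\<^esub> l b a2"
    and "r (a1 \<otimes>\<^bsub>A\<^esub> a2) b =
      (a1 \<otimes>\<^bsub>A\<^esub> r a2 b \<oplus>\<^bsub>A\<^esub> a1 \<otimes>\<^bsub>A\<^esub> l b a2) \<ominus>\<^bsub>A\<^esub> r a1 b \<otimes>\<^bsub>A\<^esub> a2"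
    and "l b a1 \<otimes>\<^bsub>A\<^esub> a2 =
      (l b (a1 \<otimes>\<^bsub>A\<^esub> a2) \<oplus>\<^bsub>A\<^esub> l b (a2 \<otimes>\<^bsub>A\<^esub> a1)) \<ominus>\<^bsub>A\<^esub> l b a2 \<otimes>\<^bsub>A\<^esub> a1"
    and "a1 \<otimes>\<^bsub>A\<^esub> r a2 b =
      (r (a1 \<otimes>\<^bsub>A\<^esub> a2) b \<oplus>\<^bsub>A\<^esub> r (a2 \<otimes>\<^bsub>A\<^esub> a1) b) \<ominus>\<^bsub>A\<^esub> a2 \<otimes>\<^bsub>A\<^esub> r a1 b"
  using act assms unfolding derived_action_gAlt_def by blast+

private lemma act_mult:
  assumes "b1 \<in> carrier B" "b2 \<in> carrier B" "a \<in> carrier A"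
  shows "l (b1 \<otimes>\<^bsub>B\<^esub> b2) a = (l b1 (l b2 a) \<oplus>\<^bsub>A\<^esub> l b1 (r a b2)) \<ominus>\<^bsub>A\<^esub> r (l b1 a) b2"
    and "r a (b1 \<otimes>\<^bsub>B\<^esub> b2) = (r (r a b1) b2 \<oplus>\<^bsub>A\<^esub> r (l b1 a) b2) \<ominus>\<^bsub>A\<^esub> l b1 (r a b2)"
  using act assms unfolding derived_action_gAlt_def by blast+

private lemma act_mult':
  assumes "b1 \<in> carrier B" "b2 \<in> carrier B" "a \<in> carrier A"
  shows "r (r a b1) b2 =
      (r a (b1 \<otimes>\<^bsub>B\<^esub> b2) \<oplus>\<^bsub>A\<^esub> r a (b2 \<otimes>\<^bsub>B\<^esub> b1)) \<ominus>\<^bsub>A\<^esub> r (r a b2) b1"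
    and "l b1 (l b2 a) =
      (l (b1 \<otimes>\<^bsub>B\<^esub> b2) a \<oplus>\<^bsub>A\<^esub> l (b2 \<otimes>\<^bsub>B\<^esub> b1) a) \<ominus>\<^bsub>A\<^esub> l b2 (l b1 a)"
  using act assms unfolding derived_action_gAlt_def by blast+

private lemma P_sel:
  "carrier P = \<pi> ` carrier B" "add P = pair_add A" "monoid.mult P = pair_mult A"
  "smult P = pair_smult A" "zero P = pair_zero A"
  by (simp_all add: pair_algebra_def)

private lemma image: "algebra_image F B P \<pi>"
proof
  note D = bilinear_mapD[OF bil(1)] bilinear_mapD[OF bil(2)]
  show "nonassoc_algebra F B"
    using act by (auto simp: derived_action_gAlt_def g_alternative_algebra_def)
  show "carrier P = \<pi> ` carrier B"
    by (rule P_sel)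
  show "\<zero>\<^bsub>P\<^esub> = \<pi> \<zero>\<^bsub>B\<^esub>"
    unfolding P_sel pair_zero_def action_pair_def by (simp add: zero_act cong: restrict_cong)
  show "\<pi> x \<oplus>\<^bsub>P\<^esub> \<pi> y = \<pi> (x \<oplus>\<^bsub>B\<^esub> y)" if "x \<in> carrier B" "y \<in> carrier B" for x y
    unfolding P_sel pair_add_def action_pair_def using that by (simp add: D cong: restrict_cong)
  show "\<pi> x \<otimes>\<^bsub>P\<^esub> \<pi> y = \<pi> (x \<otimes>\<^bsub>B\<^esub> y)" if "x \<in> carrier B" "y \<in> carrier B" for x y
    unfolding P_sel pair_mult_def action_pair_def using that
    by (simp add: D act_mult cong: restrict_cong)
  show "k \<odot>\<^bsub>P\<^esub> \<pi> x = \<pi> (k \<odot>\<^bsub>B\<^esub> x)" if "k \<in> carrier F" "x \<in> carrier B" for k x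
    unfolding P_sel pair_smult_def action_pair_def using that by (simp add: D cong: restrict_cong)
qed

private lemma \<pi>_app:
  "a \<in> carrier A \<Longrightarrow> fst (\<pi> b) a = l b a" "a \<in> carrier A \<Longrightarrow> snd (\<pi> b) a = r a b"
  by (simp_all add: action_pair_def)

private lemma action_pair_pair_algebra:
  assumes "b \<in> carrier B"
  shows "action_pair A fst (\<lambda>a f. snd f a) (\<pi> b) = \<pi> b"
  by (auto simp: action_pair_def intro!: restrict_ext)

private lemma derived_gAlt_image: "derived_action_gAlt F A P fst (\<lambda>a f. snd f a)"
proof -
  interpret I: algebra_image F B P \<pi> by (rule image)
  interpret A: module F A by (rule mods)
  interpret B: module F B by (rule mods)
  have gP: "g_alternative_algebra F P"
    using act I.g_alternative_P by (simp add: derived_action_gAlt_def)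
  note D = bilinear_mapD[OF bil(1)] bilinear_mapD[OF bil(2)]
  have 1: "bilinear_map F P A A fst" "bilinear_map F A P A (\<lambda>a f. snd f a)"
    unfolding bilinear_map_def I.carrier_image
    by (auto simp: I.\<pi>_add I.\<pi>_smult \<pi>_app D)
  show ?thesis
    unfolding derived_action_gAlt_def I.carrier_image ball_simps
  proof (intro conjI ballI, goal_cases)
    case 1 show ?case using act by (simp add: derived_action_gAlt_def)
  next
    case 2 show ?case by (rule gP)
  next
    case 3 show ?case by (rule 1)
  next
    case 4 show ?case by (rule 1)
  qed (simp only: I.\<pi>_mult \<pi>_app D(1,6) multA multB; rule act_mult act_mult' act_ids; assumption)+
qed

lemma action_pair_in_BB_gAlt:
  assumes "b \<in> carrier B"
  shows "action_pair A l r b \<in> BB_gAlt F A"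
proof -
  have "\<pi> b \<in> carrier P" using assms by (simp add: P_sel)
  then show ?thesis
    unfolding BB_gAlt_def
    using derived_gAlt_image action_pair_pair_algebra[OF assms, symmetric] by blast
qed

lemma action_pair_in_BB_Alt:
  assumes "derived_action_Alt F A B l r" and "b \<in> carrier B"
  shows "action_pair A l r b \<in> BB_Alt F A"
proof -
  interpret I: algebra_image F B P \<pi> by (rule image)
  note D = bilinear_mapD(1)[OF bil(1)] bilinear_mapD(1)[OF bil(2)]
  have "derived_action_Alt F A P fst (\<lambda>a f. snd f a)"
    using assms(1) derived_gAlt_image I.alternative_P
    unfolding derived_action_Alt_def I.carrier_image by (auto simp: \<pi>_app D)
  moreover have "\<pi> b \<in> carrier P" using assms(2) by (simp add: P_sel)
  ultimately show ?thesis
    unfolding BB_Alt_def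
    using action_pair_pair_algebra[OF assms(2), symmetric] by blast
qed

end

end

theory Submission
  imports Defs
begin

text \<open>
  Anticommutativity and alternativity give \<open>(xy)z = - x(yz)\<close>, hence \<open>2 x(y(zw)) = 0\<close>, and
  \<open>Ann A = 0\<close> forces \<open>2x = 0\<close>: the algebra is commutative and associative and signs are
  irrelevant. For a derived action, written \<open>l\<close> and \<open>r\<close> for one acting element, the identities
  become \<open>l(xy) = r(x)y\<close> and \<open>r(xy) = l(x)y\<close>, so \<open>l(x)(yz) = r(x)(yz)\<close> and \<open>l = r\<close> is a
  multiplier of \<open>A\<close>. Multipliers commute with each other, and they form a commutative
  associative algebra with a derived action, which is therefore the actor and equal to both algebras
  of pairs.
\<close>

section \<open>Bilinear calculus in \<open>A\<close>\<close>

locale ann_free_alternative =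
  fixes F :: "('f, 'k) ring_scheme" and A :: "('f, 'a, 'm) module_scheme"
  assumes alternative: "alternative_algebra F A"
    and anticomm: "anticommutative A"
    and Ann_trivial: "Ann A = {\<zero>\<^bsub>A\<^esub>}"
begin

lemma algebra: "nonassoc_algebra F A"
  using alternative by (simp add: alternative_algebra_def)

lemma galt: "g_alternative_algebra F A"
  using alternative by (rule alternative_imp_g_alternative)

lemma field_F: "field F" and module_A: "module F A"
  and bilinear: "bilinear_map F A A A (\<lambda>x y. x \<otimes>\<^bsub>A\<^esub> y)"
  using algebra by (simp_all add: nonassoc_algebra_def)

sublocale A: module F A
  by (rule module_A)

lemmas mult_closed [simp, intro] = bilinear_mapD(1)[OF bilinear]
lemmas mult_add_left = bilinear_mapD(2)[OF bilinear]
lemmas mult_add_right = bilinear_mapD(3)[OF bilinear]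
lemmas mult_smult_left = bilinear_mapD(4)[OF bilinear]
lemmas mult_smult_right = bilinear_mapD(5)[OF bilinear]

lemma mult_zero [simp]:
  assumes "x \<in> carrier A"
  shows "\<zero>\<^bsub>A\<^esub> \<otimes>\<^bsub>A\<^esub> x = \<zero>\<^bsub>A\<^esub>" "x \<otimes>\<^bsub>A\<^esub> \<zero>\<^bsub>A\<^esub> = \<zero>\<^bsub>A\<^esub>"
  using mult_smult_left[of "\<zero>\<^bsub>F\<^esub>" "\<zero>\<^bsub>A\<^esub>" x] mult_smult_right[of "\<zero>\<^bsub>F\<^esub>" x "\<zero>\<^bsub>A\<^esub>"] assms
  by simp_all

lemma mult_uminus:
  assumes "x \<in> carrier A" "y \<in> carrier A"
  shows "(\<ominus>\<^bsub>A\<^esub> x) \<otimes>\<^bsub>A\<^esub> y = \<ominus>\<^bsub>A\<^esub> (x \<otimes>\<^bsub>A\<^esub> y)" "x \<otimes>\<^bsub>A\<^esub> (\<ominus>\<^bsub>A\<^esub> y) = \<ominus>\<^bsub>A\<^esub> (x \<otimes>\<^bsub>A\<^esub> y)"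
proof -
  have "(\<ominus>\<^bsub>A\<^esub> x) \<otimes>\<^bsub>A\<^esub> y \<oplus>\<^bsub>A\<^esub> x \<otimes>\<^bsub>A\<^esub> y = \<zero>\<^bsub>A\<^esub>"
    using mult_add_left[of "\<ominus>\<^bsub>A\<^esub> x" x y] assms by (simp add: A.M.l_neg)
  then show "(\<ominus>\<^bsub>A\<^esub> x) \<otimes>\<^bsub>A\<^esub> y = \<ominus>\<^bsub>A\<^esub> (x \<otimes>\<^bsub>A\<^esub> y)"
    using assms by (intro A.M.minus_equality[symmetric]) auto
  have "x \<otimes>\<^bsub>A\<^esub> (\<ominus>\<^bsub>A\<^esub> y) \<oplus>\<^bsub>A\<^esub> x \<otimes>\<^bsub>A\<^esub> y = \<zero>\<^bsub>A\<^esub>"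
    using mult_add_right[of x "\<ominus>\<^bsub>A\<^esub> y" y] assms by (simp add: A.M.l_neg)
  then show "x \<otimes>\<^bsub>A\<^esub> (\<ominus>\<^bsub>A\<^esub> y) = \<ominus>\<^bsub>A\<^esub> (x \<otimes>\<^bsub>A\<^esub> y)"
    using assms by (intro A.M.minus_equality[symmetric]) auto
qed

section \<open>From anticommutativity to 2x = 0, commutativity and associativity\<close>

lemma mult_anticomm:
  "x \<in> carrier A \<Longrightarrow> y \<in> carrier A \<Longrightarrow> x \<otimes>\<^bsub>A\<^esub> y = \<ominus>\<^bsub>A\<^esub> (y \<otimes>\<^bsub>A\<^esub> x)"
  using anticomm unfolding anticommutative_def by blast

lemma mult_swap_sum:
  "x \<in> carrier A \<Longrightarrow> y \<in> carrier A \<Longrightarrow> x \<otimes>\<^bsub>A\<^esub> y \<oplus>\<^bsub>A\<^esub> y \<otimes>\<^bsub>A\<^esub> x = \<zero>\<^bsub>A\<^esub>"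
  using mult_anticomm[of x y] by (simp add: A.M.l_neg)

text \<open>The form in which Ann A = 0 is applied throughout: anticommutativity turns vanishing
  products on one side into vanishing products on both.\<close>

lemma eq_zero_if_mult_zero:
  assumes "u \<in> carrier A" "\<And>y. y \<in> carrier A \<Longrightarrow> u \<otimes>\<^bsub>A\<^esub> y = \<zero>\<^bsub>A\<^esub>"
  shows "u = \<zero>\<^bsub>A\<^esub>"
proof -
  have "y \<otimes>\<^bsub>A\<^esub> u = \<zero>\<^bsub>A\<^esub>" if "y \<in> carrier A" for y
    using assms that by (subst mult_anticomm) simp_all
  then have "u \<in> Ann A"
    unfolding Ann_def using assms by simp
  then show ?thesis using Ann_trivial by simp
qed

text \<open>In each g-alternative law two terms differ only by swapping an inner product, so they
  cancel by anticommutativity. What remains is the chain (xy)z = -(xz)y = y(xz) = -x(yz).\<close>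

lemma mult_antiassoc:
  assumes "x \<in> carrier A" "y \<in> carrier A" "z \<in> carrier A"
  shows "(x \<otimes>\<^bsub>A\<^esub> y) \<otimes>\<^bsub>A\<^esub> z = \<ominus>\<^bsub>A\<^esub> (x \<otimes>\<^bsub>A\<^esub> (y \<otimes>\<^bsub>A\<^esub> z))"
proof -
  have "(x \<otimes>\<^bsub>A\<^esub> y) \<otimes>\<^bsub>A\<^esub> z =
      (x \<otimes>\<^bsub>A\<^esub> (y \<otimes>\<^bsub>A\<^esub> z) \<oplus>\<^bsub>A\<^esub> x \<otimes>\<^bsub>A\<^esub> (z \<otimes>\<^bsub>A\<^esub> y)) \<ominus>\<^bsub>A\<^esub> (x \<otimes>\<^bsub>A\<^esub> z) \<otimes>\<^bsub>A\<^esub> y"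
    using galt assms unfolding g_alternative_algebra_def by blast
  also have "x \<otimes>\<^bsub>A\<^esub> (y \<otimes>\<^bsub>A\<^esub> z) \<oplus>\<^bsub>A\<^esub> x \<otimes>\<^bsub>A\<^esub> (z \<otimes>\<^bsub>A\<^esub> y) = \<zero>\<^bsub>A\<^esub>"
    using assms by (simp add: mult_add_right[symmetric] mult_swap_sum)
  also have "\<zero>\<^bsub>A\<^esub> \<ominus>\<^bsub>A\<^esub> (x \<otimes>\<^bsub>A\<^esub> z) \<otimes>\<^bsub>A\<^esub> y = y \<otimes>\<^bsub>A\<^esub> (x \<otimes>\<^bsub>A\<^esub> z)"
    using assms mult_anticomm[of y "x \<otimes>\<^bsub>A\<^esub> z"] by (simp add: a_minus_def)
  also have "y \<otimes>\<^bsub>A\<^esub> (x \<otimes>\<^bsub>A\<^esub> z) =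
      ((y \<otimes>\<^bsub>A\<^esub> x) \<otimes>\<^bsub>A\<^esub> z \<oplus>\<^bsub>A\<^esub> (x \<otimes>\<^bsub>A\<^esub> y) \<otimes>\<^bsub>A\<^esub> z) \<ominus>\<^bsub>A\<^esub> x \<otimes>\<^bsub>A\<^esub> (y \<otimes>\<^bsub>A\<^esub> z)"
    using galt assms unfolding g_alternative_algebra_def by blast
  also have "(y \<otimes>\<^bsub>A\<^esub> x) \<otimes>\<^bsub>A\<^esub> z \<oplus>\<^bsub>A\<^esub> (x \<otimes>\<^bsub>A\<^esub> y) \<otimes>\<^bsub>A\<^esub> z = \<zero>\<^bsub>A\<^esub>"
    using assms by (simp add: mult_add_left[symmetric] mult_swap_sum)
  finally show ?thesis
    using assms by (simp add: a_minus_def)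
qed

text \<open>A pentagon argument. Regrouping ((xy)z)w to x(y(zw)) through (xy)(zw) takes two
  applications of antiassociativity, through (x(yz))w it takes three; the resulting signs disagree,
  so twice the product is zero.\<close>

lemma add_self:
  assumes x: "x \<in> carrier A"
  shows "x \<oplus>\<^bsub>A\<^esub> x = \<zero>\<^bsub>A\<^esub>"
proof -
  have "((x \<oplus>\<^bsub>A\<^esub> x) \<otimes>\<^bsub>A\<^esub> y) \<otimes>\<^bsub>A\<^esub> z \<otimes>\<^bsub>A\<^esub> w = \<zero>\<^bsub>A\<^esub>"
    if c: "y \<in> carrier A" "z \<in> carrier A" "w \<in> carrier A" for y z w
  proof -
    have eq: "((x \<otimes>\<^bsub>A\<^esub> y) \<otimes>\<^bsub>A\<^esub> z) \<otimes>\<^bsub>A\<^esub> w = x \<otimes>\<^bsub>A\<^esub> (y \<otimes>\<^bsub>A\<^esub> (z \<otimes>\<^bsub>A\<^esub> w))"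
      using x c mult_antiassoc[of "x \<otimes>\<^bsub>A\<^esub> y" z w] mult_antiassoc[of x y "z \<otimes>\<^bsub>A\<^esub> w"]
      by simp
    have "((x \<otimes>\<^bsub>A\<^esub> y) \<otimes>\<^bsub>A\<^esub> z) \<otimes>\<^bsub>A\<^esub> w = \<ominus>\<^bsub>A\<^esub> (x \<otimes>\<^bsub>A\<^esub> (y \<otimes>\<^bsub>A\<^esub> (z \<otimes>\<^bsub>A\<^esub> w)))"
      using x c mult_antiassoc[of x "y \<otimes>\<^bsub>A\<^esub> z" w] mult_antiassoc[of y z w]
        mult_antiassoc[of x y z]
      by (simp add: mult_uminus)
    then have "((x \<otimes>\<^bsub>A\<^esub> y) \<otimes>\<^bsub>A\<^esub> z) \<otimes>\<^bsub>A\<^esub> w \<oplus>\<^bsub>A\<^esub> ((x \<otimes>\<^bsub>A\<^esub> y) \<otimes>\<^bsub>A\<^esub> z) \<otimes>\<^bsub>A\<^esub> w = \<zero>\<^bsub>A\<^esub>"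
      using x c A.M.r_neg[of "x \<otimes>\<^bsub>A\<^esub> (y \<otimes>\<^bsub>A\<^esub> (z \<otimes>\<^bsub>A\<^esub> w))"] eq by (metis mult_closed)
    then show ?thesis
      using x c by (simp add: mult_add_left)
  qed
  then show ?thesis
    \<comment> \<open>Three successive uses of Ann A = 0 introduce the right factors y, z and w one
      after another.\<close>
    using x by (intro eq_zero_if_mult_zero[of "x \<oplus>\<^bsub>A\<^esub> x"]
        eq_zero_if_mult_zero[of "(x \<oplus>\<^bsub>A\<^esub> x) \<otimes>\<^bsub>A\<^esub> _"]
        eq_zero_if_mult_zero[of "((x \<oplus>\<^bsub>A\<^esub> x) \<otimes>\<^bsub>A\<^esub> _) \<otimes>\<^bsub>A\<^esub> _"]) auto
qed

lemma uminus_eq: "x \<in> carrier A \<Longrightarrow> \<ominus>\<^bsub>A\<^esub> x = x"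
  by (intro A.M.minus_equality add_self)

lemma minus_eq: "x \<in> carrier A \<Longrightarrow> y \<in> carrier A \<Longrightarrow> x \<ominus>\<^bsub>A\<^esub> y = x \<oplus>\<^bsub>A\<^esub> y"
  by (simp add: a_minus_def uminus_eq)

lemma mult_comm: "x \<in> carrier A \<Longrightarrow> y \<in> carrier A \<Longrightarrow> x \<otimes>\<^bsub>A\<^esub> y = y \<otimes>\<^bsub>A\<^esub> x"
  using mult_anticomm[of x y] by (simp add: uminus_eq)

lemma mult_assoc:
  "x \<in> carrier A \<Longrightarrow> y \<in> carrier A \<Longrightarrow> z \<in> carrier A \<Longrightarrow>
    (x \<otimes>\<^bsub>A\<^esub> y) \<otimes>\<^bsub>A\<^esub> z = x \<otimes>\<^bsub>A\<^esub> (y \<otimes>\<^bsub>A\<^esub> z)"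
  using mult_antiassoc[of x y z] by (simp add: uminus_eq)

text \<open>Together with \<open>add_self\<close> this collapses the three-term right-hand sides of
  the action identities: a repeated summand disappears whatever its sign.\<close>

lemma add_cancel_self:
  "x \<in> carrier A \<Longrightarrow> y \<in> carrier A \<Longrightarrow> x \<oplus>\<^bsub>A\<^esub> (x \<oplus>\<^bsub>A\<^esub> y) = y"
  by (simp add: A.M.a_assoc[symmetric] add_self)

lemma eq_if_add_zero:
  "x \<in> carrier A \<Longrightarrow> y \<in> carrier A \<Longrightarrow> x \<oplus>\<^bsub>A\<^esub> y = \<zero>\<^bsub>A\<^esub> \<Longrightarrow> x = y"
  using uminus_eq[of y] A.M.minus_equality[of x y] by simp

text \<open>Ann A = 0 applied to the difference of u and v, which is written as a sum since signs
  are irrelevant.\<close>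

lemma eq_if_mult_eq:
  assumes "u \<in> carrier A" "v \<in> carrier A"
    and "\<And>y. y \<in> carrier A \<Longrightarrow> u \<otimes>\<^bsub>A\<^esub> y = v \<otimes>\<^bsub>A\<^esub> y"
  shows "u = v"
proof (rule eq_if_add_zero)
  show "u \<oplus>\<^bsub>A\<^esub> v = \<zero>\<^bsub>A\<^esub>"
    by (rule eq_zero_if_mult_zero) (use assms in \<open>simp_all add: mult_add_left add_self\<close>)
qed (use assms in auto)

section \<open>Multipliers: the \<open>A\<close>-linear endomorphisms of \<open>A\<close>, kept
  extensional like the components of pairs\<close>

definition multiplier :: "('a \<Rightarrow> 'a) \<Rightarrow> bool" where
  "multiplier f \<longleftrightarrow> f \<in> carrier A \<rightarrow>\<^sub>E carrier A \<and>
     (\<forall>x\<in>carrier A. \<forall>y\<in>carrier A. f (x \<oplus>\<^bsub>A\<^esub> y) = f x \<oplus>\<^bsub>A\<^esub> f y) \<and>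
     (\<forall>k\<in>carrier F. \<forall>x\<in>carrier A. f (k \<odot>\<^bsub>A\<^esub> x) = k \<odot>\<^bsub>A\<^esub> f x) \<and>
     (\<forall>x\<in>carrier A. \<forall>y\<in>carrier A. f (x \<otimes>\<^bsub>A\<^esub> y) = f x \<otimes>\<^bsub>A\<^esub> y)"

lemma multiplierD:
  assumes "multiplier f"
  shows "x \<in> carrier A \<Longrightarrow> f x \<in> carrier A"
    and "f \<in> extensional (carrier A)"
    and "x \<in> carrier A \<Longrightarrow> y \<in> carrier A \<Longrightarrow> f (x \<oplus>\<^bsub>A\<^esub> y) = f x \<oplus>\<^bsub>A\<^esub> f y"
    and "k \<in> carrier F \<Longrightarrow> x \<in> carrier A \<Longrightarrow> f (k \<odot>\<^bsub>A\<^esub> x) = k \<odot>\<^bsub>A\<^esub> f x"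
    and "x \<in> carrier A \<Longrightarrow> y \<in> carrier A \<Longrightarrow> f (x \<otimes>\<^bsub>A\<^esub> y) = f x \<otimes>\<^bsub>A\<^esub> y"
  using assms by (auto simp: multiplier_def PiE_def)

lemma multiplier_left:
  "multiplier f \<Longrightarrow> x \<in> carrier A \<Longrightarrow> y \<in> carrier A \<Longrightarrow> f x \<otimes>\<^bsub>A\<^esub> y = f (x \<otimes>\<^bsub>A\<^esub> y)"
  by (simp add: multiplierD(5))

lemma multiplier_right:
  assumes "multiplier f" "x \<in> carrier A" "y \<in> carrier A"
  shows "x \<otimes>\<^bsub>A\<^esub> f y = f (x \<otimes>\<^bsub>A\<^esub> y)"
proof -
  have "x \<otimes>\<^bsub>A\<^esub> f y = f (y \<otimes>\<^bsub>A\<^esub> x)"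
    using assms by (simp add: multiplierD(1,5) mult_comm[of x "f y"])
  then show ?thesis
    using assms by (simp add: mult_comm[of y x])
qed

text \<open>On a product, f can act on one factor while g acts on the other: f(gx)y = (gx)(fy) =
  g(x(fy)) = g((fx)y) = g(fx)y. Cancelling y gives the claim.\<close>

lemma multiplier_commute:
  assumes f: "multiplier f" and g: "multiplier g" and x: "x \<in> carrier A"
  shows "f (g x) = g (f x)"
proof (rule eq_if_mult_eq)
  note c = multiplierD(1)[OF f] multiplierD(1)[OF g]
  show "f (g x) \<in> carrier A" "g (f x) \<in> carrier A" using x c by auto
  fix y assume y: "y \<in> carrier A"
  have "f (g x) \<otimes>\<^bsub>A\<^esub> y = f (g x \<otimes>\<^bsub>A\<^esub> y)"
    using x y c by (simp add: multiplier_left[OF f])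
  also have "\<dots> = g x \<otimes>\<^bsub>A\<^esub> f y"
    using x y c by (simp add: multiplier_right[OF f])
  also have "\<dots> = g (x \<otimes>\<^bsub>A\<^esub> f y)"
    using x y c by (simp add: multiplier_left[OF g])
  also have "\<dots> = g (f x \<otimes>\<^bsub>A\<^esub> y)"
    using x y by (simp add: multiplier_left[OF f] multiplier_right[OF f])
  also have "\<dots> = g (f x) \<otimes>\<^bsub>A\<^esub> y"
    using x y c by (simp add: multiplier_left[OF g])
  finally show "f (g x) \<otimes>\<^bsub>A\<^esub> y = g (f x) \<otimes>\<^bsub>A\<^esub> y" .
qed

section \<open>Diagonal pairs of multipliers and the operations on pairs\<close>

definition multiplier_pairs :: "'a map_pair set" where
  "multiplier_pairs = {(f, f) | f. multiplier f}"

lemma multiplier_pairsE: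
  assumes "p \<in> multiplier_pairs"
  obtains f where "p = (f, f)" "multiplier f"
  using assms by (auto simp: multiplier_pairs_def)

lemma multiplier_pairsI: "multiplier f \<Longrightarrow> (f, f) \<in> multiplier_pairs"
  by (auto simp: multiplier_pairs_def)

lemma multiplierI:
  assumes "\<And>x. x \<in> carrier A \<Longrightarrow> f x \<in> carrier A"
    and "\<And>x y. x \<in> carrier A \<Longrightarrow> y \<in> carrier A \<Longrightarrow> f (x \<oplus>\<^bsub>A\<^esub> y) = f x \<oplus>\<^bsub>A\<^esub> f y"
    and "\<And>k x. k \<in> carrier F \<Longrightarrow> x \<in> carrier A \<Longrightarrow> f (k \<odot>\<^bsub>A\<^esub> x) = k \<odot>\<^bsub>A\<^esub> f x"
    and "\<And>x y. x \<in> carrier A \<Longrightarrow> y \<in> carrier A \<Longrightarrow> f (x \<otimes>\<^bsub>A\<^esub> y) = f x \<otimes>\<^bsub>A\<^esub> y"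
  shows "multiplier (restrict f (carrier A))"
  using assms unfolding multiplier_def by auto

lemma multiplier_add:
  "multiplier f \<Longrightarrow> multiplier g \<Longrightarrow> multiplier (\<lambda>x\<in>carrier A. f x \<oplus>\<^bsub>A\<^esub> g x)"
  by (rule multiplierI) (simp_all add: multiplierD mult_add_left A.smult_r_distr A.M.a_ac)

lemma multiplier_zero: "multiplier (\<lambda>x\<in>carrier A. \<zero>\<^bsub>A\<^esub>)"
  by (rule multiplierI) simp_all

lemma multiplier_smult:
  "k \<in> carrier F \<Longrightarrow> multiplier f \<Longrightarrow> multiplier (\<lambda>x\<in>carrier A. k \<odot>\<^bsub>A\<^esub> f x)"
  by (rule multiplierI) (simp_all add: multiplierD mult_smult_left A.smult_r_distr
      A.smult_assoc1[symmetric] A.R.m_comm)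

lemma multiplier_comp:
  "multiplier f \<Longrightarrow> multiplier g \<Longrightarrow> multiplier (\<lambda>x\<in>carrier A. f (g x))"
  by (rule multiplierI) (simp_all add: multiplierD)

text \<open>Since f and g commute, all three terms of either component of the product equal f(gx),
  and two of them cancel.\<close>

lemma pair_mult_multipliers:
  assumes f: "multiplier f" and g: "multiplier g"
  shows "pair_mult A (f, f) (g, g) = (\<lambda>x\<in>carrier A. f (g x), \<lambda>x\<in>carrier A. f (g x))"
  using multiplierD(1)[OF f] multiplierD(1)[OF g] multiplier_commute[OF f g]
  by (auto simp: pair_mult_def minus_eq add_self intro!: restrict_ext)

lemma pair_neg_multiplier:
  assumes f: "multiplier f"
  shows "pair_neg A (f, f) = (f, f)"
  using multiplierD(1,2)[OF f]
  by (auto simp: pair_neg_def uminus_eq intro!: extensionalityI[of _ "carrier A"])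

text \<open>Sums and composites of multipliers are multipliers and negation is the identity, so
  repeated operations produce nothing new. This later removes the closure from \<open>frakB\<close>
  and \<open>frakB_Alt\<close>.\<close>

lemma pair_closure_multiplier_pairs: "pair_closure A multiplier_pairs = multiplier_pairs"
proof
  show "pair_closure A multiplier_pairs \<subseteq> multiplier_pairs"
  proof
    fix p assume "p \<in> pair_closure A multiplier_pairs"
    then show "p \<in> multiplier_pairs"
      by induction
        (auto elim!: multiplier_pairsE intro!: multiplier_pairsI
          simp: pair_neg_multiplier pair_mult_multipliers multiplier_comp multiplier_add pair_add_def)
  qed
qed (auto intro: pair_closure.incl)

section \<open>The multiplier algebra and its derived action on \<open>A\<close>\<close>

abbreviation "multiplier_algebra \<equiv>
  (pair_algebra A multiplier_pairs :: ('f, 'a map_pair) module)"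

lemma multiplier_algebra_sel:
  "carrier multiplier_algebra = multiplier_pairs" "add multiplier_algebra = pair_add A"
  "monoid.mult multiplier_algebra = pair_mult A" "smult multiplier_algebra = pair_smult A"
  "zero multiplier_algebra = pair_zero A"
  by (simp_all add: pair_algebra_def)

text \<open>Reduces the axioms of algebras and actions, quantified over pairs, to statements about
  single multipliers.\<close>

lemma ball_multiplier_pairs:
  "(\<forall>p\<in>multiplier_pairs. P p) \<longleftrightarrow> (\<forall>f. multiplier f \<longrightarrow> P (f, f))"
  by (auto simp: multiplier_pairs_def)

lemma module_multiplier_algebra: "module F multiplier_algebra"
proof (rule moduleI)
  show "cring F" by (rule A.R.is_cring)
  show "abelian_group multiplier_algebra"
    unfolding multiplier_algebra_sel
  proof (rule abelian_groupI, unfold multiplier_algebra_sel)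
    \<comment> \<open>Every pair is its own negative, as x + x = 0 in \<open>A\<close>.\<close>
    show "\<exists>q\<in>multiplier_pairs. pair_add A q p = pair_zero A" if "p \<in> multiplier_pairs" for p
      using that
      by (intro bexI[of _ p])
        (auto simp: pair_add_def pair_zero_def add_self multiplierD(1) elim!: multiplier_pairsE)
  qed (auto simp: pair_add_def pair_zero_def multiplier_add multiplier_zero multiplierD A.M.a_ac
      elim!: multiplier_pairsE intro!: multiplier_pairsI extensionalityI[of _ "carrier A"])
qed (unfold multiplier_algebra_sel, auto simp: pair_add_def pair_smult_def multiplier_smult
    multiplierD A.smult_l_distr A.smult_r_distr A.smult_assoc1
      elim!: multiplier_pairsE intro!: multiplier_pairsI extensionalityI[of _ "carrier A"])

lemma algebra_multiplier_algebra: "nonassoc_algebra F multiplier_algebra"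
  unfolding nonassoc_algebra_def bilinear_map_def multiplier_algebra_sel ball_multiplier_pairs
  using field_F module_multiplier_algebra
  by (auto simp: pair_mult_multipliers multiplier_comp multiplier_add multiplier_smult pair_add_def
      pair_smult_def multiplierD intro!: multiplier_pairsI extensionalityI[of _ "carrier A"])

lemma alternative_multiplier_algebra: "alternative_algebra F multiplier_algebra"
  unfolding alternative_algebra_def multiplier_algebra_sel ball_multiplier_pairs
  using algebra_multiplier_algebra
  by (auto simp: pair_mult_multipliers multiplier_comp multiplierD
      intro!: extensionalityI[of _ "carrier A"])

text \<open>In each of the eight identities the right-hand side consists of three terms equal to the
  left-hand side, either f(xy) or f(gx), so two of them cancel.\<close>

lemma derived_action_gAlt_multiplier_algebra:
  "derived_action_gAlt F A multiplier_algebra fst (\<lambda>a f. snd f a)"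
  unfolding derived_action_gAlt_def bilinear_map_def multiplier_algebra_sel ball_multiplier_pairs
  using galt alternative_imp_g_alternative[OF alternative_multiplier_algebra]
  by (auto simp: pair_add_def pair_smult_def pair_mult_multipliers multiplierD(1,3,4) minus_eq
      add_self multiplier_left multiplier_right add_cancel_self A.M.a_ac mult_comm
      intro: multiplier_commute)

text \<open>The two extra identities hold because left and right action coincide: both sides are
  f(aa) in the first and f(fa) in the second.\<close>

lemma derived_action_Alt_multiplier_algebra:
  "derived_action_Alt F A multiplier_algebra fst (\<lambda>a f. snd f a)"
  using derived_action_gAlt_multiplier_algebra alternative alternative_multiplier_algebra
  unfolding derived_action_Alt_def multiplier_algebra_sel ball_multiplier_pairs
  by (auto simp: multiplier_left multiplier_right multiplierD(1))

section \<open>Every derived action is by multipliers\<close>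

lemma action_eq:
  assumes act: "derived_action_gAlt F A B l r" and b: "b \<in> carrier B"
  shows "\<And>x. x \<in> carrier A \<Longrightarrow> r x b = l b x"
    and "\<And>x y. x \<in> carrier A \<Longrightarrow> y \<in> carrier A \<Longrightarrow> l b (x \<otimes>\<^bsub>A\<^esub> y) = l b x \<otimes>\<^bsub>A\<^esub> y"
proof -
  have bil: "bilinear_map F B A A l" "bilinear_map F A B A r"
    using act by (auto simp: derived_action_gAlt_def)
  have closed [simp]: "l b x \<in> carrier A" "r x b \<in> carrier A" if "x \<in> carrier A" for x
    using that b bilinear_mapD(1)[OF bil(1)] bilinear_mapD(1)[OF bil(2)] by auto
  \<comment> \<open>The first two terms of the identity for (bx)y agree by commutativity and cancel,
    so l can be moved from one factor to the other. Below, \<open>r1\<close> does the same for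
    r.\<close>
  have left: "x \<otimes>\<^bsub>A\<^esub> l b y = l b x \<otimes>\<^bsub>A\<^esub> y" if "x \<in> carrier A" "y \<in> carrier A" for x y
  proof -
    have "l b x \<otimes>\<^bsub>A\<^esub> y =
        (l b (x \<otimes>\<^bsub>A\<^esub> y) \<oplus>\<^bsub>A\<^esub> l b (y \<otimes>\<^bsub>A\<^esub> x)) \<ominus>\<^bsub>A\<^esub> l b y \<otimes>\<^bsub>A\<^esub> x"
      using act b that unfolding derived_action_gAlt_def by blast
    then show ?thesis
      using that by (simp add: mult_comm[of y x] minus_eq add_self mult_comm[of x "l b y"])
  qed
  \<comment> \<open>By \<open>left\<close> the outer terms of the identity for b(xy) cancel and only
    the r term survives; \<open>rl\<close> is the mirror image.\<close>
  have lr: "l b (x \<otimes>\<^bsub>A\<^esub> y) = r x b \<otimes>\<^bsub>A\<^esub> y" if "x \<in> carrier A" "y \<in> carrier A" for x y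
  proof -
    have "l b (x \<otimes>\<^bsub>A\<^esub> y) = (l b x \<otimes>\<^bsub>A\<^esub> y \<oplus>\<^bsub>A\<^esub> r x b \<otimes>\<^bsub>A\<^esub> y) \<ominus>\<^bsub>A\<^esub> x \<otimes>\<^bsub>A\<^esub> l b y"
      using act b that unfolding derived_action_gAlt_def by blast
    then show ?thesis
      using that by (simp add: left minus_eq A.M.a_ac add_cancel_self add_self)
  qed
  have rl: "r (x \<otimes>\<^bsub>A\<^esub> y) b = l b x \<otimes>\<^bsub>A\<^esub> y" if "x \<in> carrier A" "y \<in> carrier A" for x y
  proof -
    have r1: "x \<otimes>\<^bsub>A\<^esub> r y b = r x b \<otimes>\<^bsub>A\<^esub> y"
    proof -
      have "x \<otimes>\<^bsub>A\<^esub> r y b =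
          (r (x \<otimes>\<^bsub>A\<^esub> y) b \<oplus>\<^bsub>A\<^esub> r (y \<otimes>\<^bsub>A\<^esub> x) b) \<ominus>\<^bsub>A\<^esub> y \<otimes>\<^bsub>A\<^esub> r x b"
        using act b that unfolding derived_action_gAlt_def by blast
      then show ?thesis
        using that by (simp add: mult_comm[of y x] minus_eq add_self mult_comm[of y "r x b"])
    qed
    have "r (x \<otimes>\<^bsub>A\<^esub> y) b = (x \<otimes>\<^bsub>A\<^esub> r y b \<oplus>\<^bsub>A\<^esub> x \<otimes>\<^bsub>A\<^esub> l b y) \<ominus>\<^bsub>A\<^esub> r x b \<otimes>\<^bsub>A\<^esub> y"
      using act b that unfolding derived_action_gAlt_def by blast
    then show ?thesis
      using that by (simp add: left r1 minus_eq A.M.a_ac add_cancel_self add_self)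
  qed
  show eq: "r x b = l b x" if x: "x \<in> carrier A" for x
  \<comment> \<open>Multiplying by y and then by z leaves room to regroup: \<open>lr\<close> reads
    l(x(yz)) as r(x)(yz), while on (xy)z it gives r(xy)z, which \<open>rl\<close> turns into
    (l(x)y)z. Associativity equates the two, and y and z are cancelled in turn.\<close>
  proof (rule eq_if_mult_eq, goal_cases)
    case (3 y)
    show ?case
    proof (rule eq_if_mult_eq, goal_cases)
      case (3 z)
      note c = \<open>y \<in> carrier A\<close> \<open>z \<in> carrier A\<close>
      have "(r x b \<otimes>\<^bsub>A\<^esub> y) \<otimes>\<^bsub>A\<^esub> z = l b (x \<otimes>\<^bsub>A\<^esub> (y \<otimes>\<^bsub>A\<^esub> z))"
        using x c by (simp add: lr mult_assoc)
      also have "\<dots> = l b ((x \<otimes>\<^bsub>A\<^esub> y) \<otimes>\<^bsub>A\<^esub> z)"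
        using x c by (simp add: mult_assoc)
      also have "\<dots> = (l b x \<otimes>\<^bsub>A\<^esub> y) \<otimes>\<^bsub>A\<^esub> z"
        using x c lr[of "x \<otimes>\<^bsub>A\<^esub> y" z] by (simp add: rl)
      finally show "(r x b \<otimes>\<^bsub>A\<^esub> y) \<otimes>\<^bsub>A\<^esub> z = (l b x \<otimes>\<^bsub>A\<^esub> y) \<otimes>\<^bsub>A\<^esub> z" .
    qed (use x \<open>y \<in> carrier A\<close> in auto)
  qed (use x in auto)
  show "l b (x \<otimes>\<^bsub>A\<^esub> y) = l b x \<otimes>\<^bsub>A\<^esub> y" if "x \<in> carrier A" "y \<in> carrier A" for x y
    using that lr eq by simp
qed

lemma action_pair_in_multiplier_pairs:
  assumes act: "derived_action_gAlt F A B l r" and b: "b \<in> carrier B"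
  shows "action_pair A l r b \<in> multiplier_pairs"
proof -
  have bil: "bilinear_map F B A A l"
    using act by (auto simp: derived_action_gAlt_def)
  have "multiplier (\<lambda>a\<in>carrier A. l b a)"
    unfolding multiplier_def
    using bilinear_mapD[OF bil] b action_eq(2)[OF act b] by auto
  moreover have "action_pair A l r b = (\<lambda>a\<in>carrier A. l b a, \<lambda>a\<in>carrier A. l b a)"
    using action_eq(1)[OF act b] by (auto simp: action_pair_def intro!: restrict_ext)
  ultimately show ?thesis
    by (simp add: multiplier_pairsI)
qed

text \<open>A cycle of inclusions: multiplier pairs lie in \<open>BB_Alt\<close>, which lies in
  \<open>BB_gAlt\<close>, whose members are multiplier pairs by \<open>action_eq\<close>.\<close>

lemma BB_Alt_eq: "BB_Alt F A = multiplier_pairs"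
  and BB_gAlt_eq: "BB_gAlt F A = multiplier_pairs"
proof -
  have "p \<in> BB_Alt F A" if "p \<in> multiplier_pairs" for p
  proof -
    \<comment> \<open>The witness is the multiplier algebra acting by evaluation; the pair that p
      induces is p itself because its components are extensional.\<close>
    have "action_pair A fst (\<lambda>a f. snd f a) p = p"
      using that by (auto simp: action_pair_def extensional_restrict multiplierD(2)
          elim!: multiplier_pairsE)
    then show ?thesis
      unfolding BB_Alt_def mem_Collect_eq
      using derived_action_Alt_multiplier_algebra that multiplier_algebra_sel(1) by metis
  qed
  moreover have "BB_Alt F A \<subseteq> BB_gAlt F A"
    unfolding BB_Alt_def BB_gAlt_def derived_action_Alt_def by blast
  moreover have "BB_gAlt F A \<subseteq> multiplier_pairs"
    unfolding BB_gAlt_def by (auto intro: action_pair_in_multiplier_pairs)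
  ultimately show "BB_Alt F A = multiplier_pairs" "BB_gAlt F A = multiplier_pairs"
    by blast+
qed

section \<open>The universal property and the algebras of pairs\<close>

lemma action_pair_hom:
  assumes act: "derived_action_gAlt F A C l r"
  shows "restrict (action_pair A l r) (carrier C) \<in> algebra_hom F C multiplier_algebra"
proof -
  have bil: "bilinear_map F C A A l" "bilinear_map F A C A r"
    and alg: "nonassoc_algebra F C"
    using act by (auto simp: derived_action_gAlt_def g_alternative_algebra_def)
  interpret C: module F C
    using alg by (simp add: nonassoc_algebra_def)
  have mult_closed_C: "x \<otimes>\<^bsub>C\<^esub> y \<in> carrier C" if "x \<in> carrier C" "y \<in> carrier C" for x y
    using alg that by (auto simp: nonassoc_algebra_def bilinear_map_def)
  have act_mult: "l (x \<otimes>\<^bsub>C\<^esub> y) a = (l x (l y a) \<oplus>\<^bsub>A\<^esub> l x (r a y)) \<ominus>\<^bsub>A\<^esub> r (l x a) y"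
    "r a (x \<otimes>\<^bsub>C\<^esub> y) = (r (r a x) y \<oplus>\<^bsub>A\<^esub> r (l x a) y) \<ominus>\<^bsub>A\<^esub> l x (r a y)"
    if "x \<in> carrier C" "y \<in> carrier C" "a \<in> carrier A" for x y a
    using act that unfolding derived_action_gAlt_def by blast+
  note D = bilinear_mapD[OF bil(1)] bilinear_mapD[OF bil(2)]
  \<comment> \<open>Multiplicativity holds because \<open>pair_mult\<close> copies the identities
    for (xy)a and a(xy); additivity and scalars come from bilinearity of the action.\<close>
  show ?thesis
    unfolding algebra_hom_def multiplier_algebra_sel
    using action_pair_in_multiplier_pairs[OF act]
    by (auto simp: mult_closed_C D act_mult pair_add_def pair_smult_def pair_mult_def
        action_pair_def intro!: restrict_ext)
qed

lemma is_actor_multiplier_algebra: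
  "is_actor_Alt TYPE('c) F A multiplier_algebra fst (\<lambda>a f. snd f a)"
  unfolding is_actor_Alt_def
proof (intro conjI allI impI)
  show "derived_action_Alt F A multiplier_algebra fst (\<lambda>a f. snd f a)"
    by (rule derived_action_Alt_multiplier_algebra)
  fix C :: "('f, 'c) module" and l r
  assume "derived_action_Alt F A C l r"
  then have act: "derived_action_gAlt F A C l r"
    by (simp add: derived_action_Alt_def)
  let ?\<phi> = "restrict (action_pair A l r) (carrier C)"
  show "\<exists>!\<phi>. \<phi> \<in> algebra_hom F C multiplier_algebra \<and>
      (\<forall>c\<in>carrier C. \<forall>a\<in>carrier A. l c a = fst (\<phi> c) a \<and> r a c = snd (\<phi> c) a)"
  proof (rule ex1I[of _ ?\<phi>])
    show "?\<phi> \<in> algebra_hom F C multiplier_algebra \<and>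
        (\<forall>c\<in>carrier C. \<forall>a\<in>carrier A. l c a = fst (?\<phi> c) a \<and> r a c = snd (?\<phi> c) a)"
      using action_pair_hom[OF act] by (simp add: action_pair_def)
  next
    fix \<phi>
    assume \<phi>: "\<phi> \<in> algebra_hom F C multiplier_algebra \<and>
      (\<forall>c\<in>carrier C. \<forall>a\<in>carrier A. l c a = fst (\<phi> c) a \<and> r a c = snd (\<phi> c) a)"
    then have mem: "\<phi> \<in> carrier C \<rightarrow>\<^sub>E multiplier_pairs"
      by (simp add: algebra_hom_def multiplier_algebra_sel)
    show "\<phi> = ?\<phi>"
    proof (rule extensionalityI[of _ "carrier C"])
      fix c assume c: "c \<in> carrier C"
      obtain f where f: "\<phi> c = (f, f)" "multiplier f"
        using mem c by (blast elim: multiplier_pairsE)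
      \<comment> \<open>Uniqueness: compatibility with the actions prescribes the values of \<phi> c
        on \<open>A\<close>, and extensionality leaves no other freedom in the pair.\<close>
      have "f = (\<lambda>a\<in>carrier A. l c a)" "f = (\<lambda>a\<in>carrier A. r a c)"
        using f \<phi> c multiplierD(2)[OF f(2)]
        by (auto intro!: extensionalityI[of _ "carrier A"])
      then show "\<phi> c = ?\<phi> c"
        using c f(1) by (simp add: action_pair_def)
    qed (use mem in \<open>auto simp: PiE_def\<close>)
  qed
qed

text \<open>Both generating sets are the multiplier pairs, which are already closed.\<close>

lemma frakB_Alt_eq: "frakB_Alt F A = multiplier_algebra"
  and frakB_eq: "frakB F A = multiplier_algebra"
  by (simp_all add: frakB_Alt_def frakB_def BB_Alt_eq BB_gAlt_eq pair_closure_multiplier_pairs)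

end

theorem theorem7p3:
  fixes F :: "('f, 'k) ring_scheme" and A :: "('f, 'a, 'm) module_scheme"
  assumes "field F"
    and "alternative_algebra F A"
    and "anticommutative A"
    and "Ann A = {\<zero>\<^bsub>A\<^esub>}"
  shows "(\<exists>(Act :: ('f, 'a map_pair) module) l r. is_actor_Alt TYPE('c) F A Act l r) \<and>
    is_actor_Alt TYPE('c) F A (frakB_Alt F A) fst (\<lambda>a f. snd f a) \<and>
    frakB_Alt F A = frakB F A"
proof -
  interpret ann_free_alternative F A
    using assms by unfold_locales
  show ?thesis
    \<comment> \<open>Both algebras of pairs rewrite to the multiplier algebra, which also witnesses
      the existence of an actor.\<close>
    using is_actor_multiplier_algebra unfolding frakB_Alt_eq frakB_eq by blast
qed

end
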